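(* Let $U$ be an admissible matrix with $k$ columns and let $r(U)$ be its number of rows. Then every proper congruence of the $k$-variable Laurent polynomial semiring $\mathbb{B}(\pmb x)$ containing $P(U)$ is an element of the strictly increasing chain $$P(U)=P(U(r(U)))\subset P(U(r(U)-1))\subset\dots\subset P(U(0)).$$ In particular every proper congruence of $\mathbb{B}(\pmb x)/P(U)$ is prime and $\dim(\mathbb{B}(\pmb x)/P(U))=r(U)$.
   Context: A semiring is a commutative semiring with additive identity $0$ and multiplicative identity $1$, with $1\neq 0$ and $a\cdot 0=0$ for all $a$. $\mathbb{B}=\{0,1\}$ is the two-element semifield with $1+1=1$. For $\pmb x=(x_1,\dots,x_k)$, $\mathbb{B}(\pmb x)$ is the semiring of formal finite sums of Laurent monomials $\pmb x^{\pmb n}$, $\pmb n\in\mathbb{Z}^k$, with coefficients in $\mathbb{B}$. A congruence of $A$ is an equivalence relation $I\subseteq A\times A$ compatible with addition and multiplication; it is proper if $I\ne A\times A$. A congruence $P$ is prime if it is proper and for all pairs $\alpha,\beta\in A\times A$ such that the twisted product $\alpha\beta=(\alpha_1\beta_1+\alpha_2\beta_2,\alpha_1\beta_2+\alpha_2\beta_1)$ is in $P$, we have $\alpha\in P$ or $\beta\in P$. $\dim(A)$ is the length (number of strict inclusions) of the longest chain of prime congruences of $A$. A real matrix $U$ with $k$ columns is admissible if for each row index $i$ there is $\pmb n\in\mathbb{Z}^k$ such that the first non-zero coordinate of $U\pmb n$ is the $i$-th one; the matrix with zero rows is allowed. (The rows of an admissible matrix are linearly independent, so $r(U)$ is also the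 rank of $U$.) $P(U)$ is the congruence of $\mathbb{B}(\pmb x)$ generated by the pairs $(\pmb x^{\pmb n_1}+\pmb x^{\pmb n_2},\pmb x^{\pmb n_2})$ such that $U(\pmb n_2-\pmb n_1)=\pmb 0$ or the first non-zero coordinate of $U(\pmb n_2-\pmb n_1)$ is positive. $U(i)$ denotes the matrix consisting of the first $i$ rows of $U$ (again admissible); $U(0)$ is the matrix with zero rows, and $P(U(0))$ is the congruence identifying every non-zero element with $1$. *)

theory Defs
  imports
    "HOL-Library.Poly_Mapping"
    "HOL-Library.Extended_Real"
    "HOL-Algebra.Ring"
    "Jordan_Normal_Form.Matrix"
begin

section \<open>Congruences of semirings\<close>

text \<open>
  Semirings are carrier-based records of type \<open>'a ring\<close> (in the sense of the locale
  \<^locale>\<open>semiring\<close>), because the quotients formed below depend on a term.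
\<close>

definition congruence :: "('a, 'm) ring_scheme \<Rightarrow> ('a \<times> 'a) set \<Rightarrow> bool" where
  "congruence A I \<longleftrightarrow>
     equiv (carrier A) I \<and>
     (\<forall>a b c d. (a, b) \<in> I \<longrightarrow> (c, d) \<in> I \<longrightarrow>
        (a \<oplus>\<^bsub>A\<^esub> c, b \<oplus>\<^bsub>A\<^esub> d) \<in> I \<and> (a \<otimes>\<^bsub>A\<^esub> c, b \<otimes>\<^bsub>A\<^esub> d) \<in> I)"

definition proper_congruence :: "('a, 'm) ring_scheme \<Rightarrow> ('a \<times> 'a) set \<Rightarrow> bool" where
  "proper_congruence A I \<longleftrightarrow> congruence A I \<and> I \<noteq> carrier A \<times> carrier A"

definition twisted_product :: "('a, 'm) ring_scheme \<Rightarrow> 'a \<times> 'a \<Rightarrow> 'a \<times> 'a \<Rightarrow> 'a \<times> 'a" where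
  "twisted_product A \<alpha> \<beta> =
     (fst \<alpha> \<otimes>\<^bsub>A\<^esub> fst \<beta> \<oplus>\<^bsub>A\<^esub> snd \<alpha> \<otimes>\<^bsub>A\<^esub> snd \<beta>,
      fst \<alpha> \<otimes>\<^bsub>A\<^esub> snd \<beta> \<oplus>\<^bsub>A\<^esub> snd \<alpha> \<otimes>\<^bsub>A\<^esub> fst \<beta>)"

definition prime_congruence :: "('a, 'm) ring_scheme \<Rightarrow> ('a \<times> 'a) set \<Rightarrow> bool" where
  "prime_congruence A P \<longleftrightarrow>
     proper_congruence A P \<and>
     (\<forall>\<alpha> \<in> carrier A \<times> carrier A. \<forall>\<beta> \<in> carrier A \<times> carrier A.
        twisted_product A \<alpha> \<beta> \<in> P \<longrightarrow> \<alpha> \<in> P \<or> \<beta> \<in> P)"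

text \<open>
  The dimension is taken in the extended reals, so that it is \<open>\<infinity>\<close> if there are arbitrarily
  long chains and \<open>-\<infinity>\<close> (not \<open>0\<close>) if there is no prime congruence at all.
\<close>

definition prime_chain :: "('a, 'm) ring_scheme \<Rightarrow> nat \<Rightarrow> (nat \<Rightarrow> ('a \<times> 'a) set) \<Rightarrow> bool" where
  "prime_chain A n C \<longleftrightarrow>
     (\<forall>i\<le>n. prime_congruence A (C i)) \<and> (\<forall>i<n. C i \<subset> C (Suc i))"

definition semiring_dim :: "('a, 'm) ring_scheme \<Rightarrow> ereal" where
  "semiring_dim A = (SUP n \<in> {n. \<exists>C. prime_chain A n C}. ereal (real n))"

definition generated_congruence ::
    "('a, 'm) ring_scheme \<Rightarrow> ('a \<times> 'a) set \<Rightarrow> ('a \<times> 'a) set" where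
  "generated_congruence A S = \<Inter>{I. congruence A I \<and> S \<subseteq> I}"

definition quotient_semiring :: "('a, 'm) ring_scheme \<Rightarrow> ('a \<times> 'a) set \<Rightarrow> 'a set ring" where
  "quotient_semiring A I =
     \<lparr>carrier = carrier A // I,
      monoid.mult = (\<lambda>X Y. \<Union>x\<in>X. \<Union>y\<in>Y. I `` {x \<otimes>\<^bsub>A\<^esub> y}),
      one = I `` {\<one>\<^bsub>A\<^esub>},
      ring.zero = I `` {\<zero>\<^bsub>A\<^esub>},
      add = (\<lambda>X Y. \<Union>x\<in>X. \<Union>y\<in>Y. I `` {x \<oplus>\<^bsub>A\<^esub> y})\<rparr>"

lemma congruence_class_eq:
  assumes "congruence A I" "(a, b) \<in> I"
  shows "I `` {a} = I `` {b}"
  using assms equiv_class_eq unfolding congruence_def by metis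

lemma quotient_semiring_ops:
  assumes I: "congruence A I" and a: "a \<in> carrier A" and b: "b \<in> carrier A"
  shows "I `` {a} \<oplus>\<^bsub>quotient_semiring A I\<^esub> I `` {b} = I `` {a \<oplus>\<^bsub>A\<^esub> b}"
    and "I `` {a} \<otimes>\<^bsub>quotient_semiring A I\<^esub> I `` {b} = I `` {a \<otimes>\<^bsub>A\<^esub> b}"
proof -
  have self: "a \<in> I `` {a}" "b \<in> I `` {b}"
    using assms equiv_class_self unfolding congruence_def by metis+
  have "I `` {x \<oplus>\<^bsub>A\<^esub> y} = I `` {a \<oplus>\<^bsub>A\<^esub> b}" "I `` {x \<otimes>\<^bsub>A\<^esub> y} = I `` {a \<otimes>\<^bsub>A\<^esub> b}"
    if "x \<in> I `` {a}" "y \<in> I `` {b}" for x y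
  proof -
    have "(a \<oplus>\<^bsub>A\<^esub> b, x \<oplus>\<^bsub>A\<^esub> y) \<in> I" "(a \<otimes>\<^bsub>A\<^esub> b, x \<otimes>\<^bsub>A\<^esub> y) \<in> I"
      using that I by (simp_all add: congruence_def)
    then show "I `` {x \<oplus>\<^bsub>A\<^esub> y} = I `` {a \<oplus>\<^bsub>A\<^esub> b}" "I `` {x \<otimes>\<^bsub>A\<^esub> y} = I `` {a \<otimes>\<^bsub>A\<^esub> b}"
      using congruence_class_eq[OF I] by simp_all
  qed
  then have
    "(\<Union>x\<in>I `` {a}. \<Union>y\<in>I `` {b}. I `` {x \<oplus>\<^bsub>A\<^esub> y}) = I `` {a \<oplus>\<^bsub>A\<^esub> b}"
    "(\<Union>x\<in>I `` {a}. \<Union>y\<in>I `` {b}. I `` {x \<otimes>\<^bsub>A\<^esub> y}) = I `` {a \<otimes>\<^bsub>A\<^esub> b}"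
    using self by blast+
  then show "I `` {a} \<oplus>\<^bsub>quotient_semiring A I\<^esub> I `` {b} = I `` {a \<oplus>\<^bsub>A\<^esub> b}"
    and "I `` {a} \<otimes>\<^bsub>quotient_semiring A I\<^esub> I `` {b} = I `` {a \<otimes>\<^bsub>A\<^esub> b}"
    by (simp_all add: quotient_semiring_def)
qed


section \<open>The Laurent polynomial semiring over the two-element semifield\<close>

datatype boolean_semifield = B0 | B1

instantiation boolean_semifield :: comm_semiring_1
begin

definition zero_boolean_semifield :: boolean_semifield where "0 = B0"
definition one_boolean_semifield :: boolean_semifield where "1 = B1"
definition plus_boolean_semifield :: "boolean_semifield \<Rightarrow> boolean_semifield \<Rightarrow> boolean_semifield"
  where "a + b = (if a = B0 then b else B1)"
definition times_boolean_semifield :: "boolean_semifield \<Rightarrow> boolean_semifield \<Rightarrow> boolean_semifield"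
  where "a * b = (if a = B0 then B0 else b)"

instance
proof
  fix a b c :: boolean_semifield
  show "a + b + c = a + (b + c)" "a + b = b + a" "0 + a = a"
    "a * b * c = a * (b * c)" "a * b = b * a" "1 * a = a"
    "(a + b) * c = a * c + b * c" "0 * a = 0" "a * 0 = 0" "(0::boolean_semifield) \<noteq> 1"
    by (cases a; cases b; cases c;
        simp add: zero_boolean_semifield_def one_boolean_semifield_def
          plus_boolean_semifield_def times_boolean_semifield_def)+
qed

end

text \<open>
  The group \<open>\<int>\<^sup>k\<close> of exponents is embedded into the finitely supported functions
  \<open>nat \<Rightarrow>\<^sub>0 int\<close> as those supported on \<open>{..<k}\<close>; thus \<open>k\<close> may be any natural number.
\<close>

definition exponents :: "nat \<Rightarrow> (nat \<Rightarrow>\<^sub>0 int) set" where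
  "exponents k = {n. Poly_Mapping.keys n \<subseteq> {..<k}}"

definition exponent_vec :: "nat \<Rightarrow> (nat \<Rightarrow>\<^sub>0 int) \<Rightarrow> real vec" where
  "exponent_vec k n = vec k (\<lambda>j. real_of_int (Poly_Mapping.lookup n j))"

type_synonym laurent = "(nat \<Rightarrow>\<^sub>0 int) \<Rightarrow>\<^sub>0 boolean_semifield"

definition laurent_monomial :: "(nat \<Rightarrow>\<^sub>0 int) \<Rightarrow> laurent" where
  "laurent_monomial n = Poly_Mapping.single n 1"

definition laurent_semiring :: "nat \<Rightarrow> laurent ring" where
  "laurent_semiring k =
     \<lparr>carrier = {p. Poly_Mapping.keys p \<subseteq> exponents k},
      monoid.mult = (*), one = 1, ring.zero = 0, add = (+)\<rparr>"

lemma exponents_closed: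
  "0 \<in> exponents k"
  "m \<in> exponents k \<Longrightarrow> n \<in> exponents k \<Longrightarrow> m + n \<in> exponents k"
  using Poly_Mapping.keys_add[of m n] by (auto simp: exponents_def)

lemma semiring_laurent_semiring: "semiring (laurent_semiring k)"
  and comm_monoid_laurent_semiring: "comm_monoid (laurent_semiring k)"
proof -
  have add: "Poly_Mapping.keys (p + q) \<subseteq> exponents k"
    and mult: "Poly_Mapping.keys (p * q) \<subseteq> exponents k"
    if "Poly_Mapping.keys p \<subseteq> exponents k" "Poly_Mapping.keys q \<subseteq> exponents k"
    for p q :: laurent
  proof -
    show "Poly_Mapping.keys (p + q) \<subseteq> exponents k"
      using that Poly_Mapping.keys_add[of p q] by blast
    show "Poly_Mapping.keys (p * q) \<subseteq> exponents k"
    proof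
      fix m assume "m \<in> Poly_Mapping.keys (p * q)"
      then obtain a b where "m = a + b" "a \<in> Poly_Mapping.keys p" "b \<in> Poly_Mapping.keys q"
        using keys_mult[of p q] by blast
      then show "m \<in> exponents k"
        using that exponents_closed(2)[of a k b] by blast
    qed
  qed
  have zero: "Poly_Mapping.keys (0::laurent) \<subseteq> exponents k"
    and one: "Poly_Mapping.keys (1::laurent) \<subseteq> exponents k"
    by (simp_all add: exponents_closed)
  show "semiring (laurent_semiring k)"
  proof (intro semiring.intro abelian_monoidI monoidI semiring_axioms.intro)
  qed (simp_all add: laurent_semiring_def add mult zero one add.assoc mult.assoc
        distrib_left distrib_right del: keys_zero keys_one, simp_all add: add.commute)
  show "comm_monoid (laurent_semiring k)"
    by (intro comm_monoidI)
      (simp_all add: laurent_semiring_def mult one mult.assoc del: keys_one,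
       simp add: mult.commute)
qed


section \<open>Admissible matrices and their congruences\<close>

definition first_nonzero_at :: "real vec \<Rightarrow> nat \<Rightarrow> bool" where
  "first_nonzero_at v i \<longleftrightarrow> i < dim_vec v \<and> v $ i \<noteq> 0 \<and> (\<forall>j<i. v $ j = 0)"

definition admissible :: "real mat \<Rightarrow> bool" where
  "admissible U \<longleftrightarrow>
     (\<forall>i<dim_row U. \<exists>n \<in> exponents (dim_col U).
        first_nonzero_at (U *\<^sub>v exponent_vec (dim_col U) n) i)"

definition matrix_congruence :: "real mat \<Rightarrow> (laurent \<times> laurent) set" where
  "matrix_congruence U =
     generated_congruence (laurent_semiring (dim_col U))
       {(laurent_monomial n\<^sub>1 + laurent_monomial n\<^sub>2, laurent_monomial n\<^sub>2) | n\<^sub>1 n\<^sub>2.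
          n\<^sub>1 \<in> exponents (dim_col U) \<and> n\<^sub>2 \<in> exponents (dim_col U) \<and>
          (let v = U *\<^sub>v exponent_vec (dim_col U) (n\<^sub>2 - n\<^sub>1) in
             v = 0\<^sub>v (dim_row U) \<or> (\<exists>i. first_nonzero_at v i \<and> v $ i > 0))}"

definition first_rows :: "real mat \<Rightarrow> nat \<Rightarrow> real mat" where
  "first_rows U i = mat_of_rows (dim_col U) (take i (rows U))"

end

theory Submission
  imports Defs
begin

text \<open>
  The matrix \<open>U\<close> orders the exponents lexicographically by the coordinates of \<open>U n\<close>, and a pair
  belongs to \<open>P(U)\<close> iff its two sets of exponents are mutually cofinal for this preorder; for a total
  preorder, a twisted product of two unrelated pairs has unrelated entries, because the product
  of the two leading monomials strictly dominates one entry. A proper congruence \<open>I\<close> above \<open>P(U)\<close>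
  is determined by the semigroup of all \<open>n\<close> with \<open>(1 + x\<^sup>n, x\<^sup>n) \<in> I\<close>, since modulo
  \<open>P(U)\<close> every non-zero polynomial is equivalent to its leading monomial. That semigroup contains the
  non-negative cone of \<open>U\<close>, hence is determined by its group of units, a convex subgroup, and these
  are the kernels of the matrices \<open>U(i)\<close>.
\<close>

section \<open>Boolean polynomials as finite sets of exponents\<close>

lemma boolean_semifield_add_eq_0 [simp]: "(a :: boolean_semifield) + b = 0 \<longleftrightarrow> a = 0 \<and> b = 0"
  by (simp add: plus_boolean_semifield_def zero_boolean_semifield_def)

lemma boolean_semifield_nonzero: "(a :: boolean_semifield) \<noteq> 0 \<Longrightarrow> a = 1"
  by (metis boolean_semifield.exhaust one_boolean_semifield_def zero_boolean_semifield_def)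

text \<open>The only non-zero coefficient is \<open>1\<close>, so a polynomial carries no more
  information than its support, and identities can be checked on \<open>keys\<close>.\<close>

lemma boolean_poly_mapping_eqI:
  fixes p q :: "'a \<Rightarrow>\<^sub>0 boolean_semifield"
  assumes "Poly_Mapping.keys p = Poly_Mapping.keys q"
  shows "p = q"
proof (rule poly_mapping_eqI)
  fix a
  show "Poly_Mapping.lookup p a = Poly_Mapping.lookup q a"
    using assms boolean_semifield_nonzero by (metis in_keys_iff)
qed

text \<open>Sums in the semifield never cancel, so the usual inclusion of supports becomes an
  equality.\<close>

lemma keys_boolean_add:
  "Poly_Mapping.keys (p + q :: 'a \<Rightarrow>\<^sub>0 boolean_semifield) = Poly_Mapping.keys p \<union> Poly_Mapping.keys q"
  by (auto simp: in_keys_iff lookup_add)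

lemma boolean_poly_mapping_induct [case_names zero monomial_add]:
  fixes p :: "'a \<Rightarrow>\<^sub>0 boolean_semifield"
  assumes "P 0"
    and step: "\<And>a p. P p \<Longrightarrow> P (Poly_Mapping.single a 1 + p)"
  shows "P p"
proof (induction p rule: update_induct)
  case const
  then show ?case using assms(1) .
next
  case (update f a b)
  \<comment> \<open>As \<open>b\<close> is non-zero, both sides have the support of \<open>f\<close>
    enlarged by \<open>a\<close>.\<close>
  have "Poly_Mapping.update a b f = Poly_Mapping.single a 1 + f"
    using update(2) by (intro boolean_poly_mapping_eqI) (simp add: keys_boolean_add keys_update)
  then show ?case using step update by simp
qed

text \<open>This is the full Minkowski sum: without cancellation every sum of exponents
  survives.\<close>

lemma keys_boolean_mult:
  fixes p q :: "'a :: monoid_add \<Rightarrow>\<^sub>0 boolean_semifield"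
  shows "Poly_Mapping.keys (p * q) = {a + b | a b. a \<in> Poly_Mapping.keys p \<and> b \<in> Poly_Mapping.keys q}"
proof (induction p rule: boolean_poly_mapping_induct)
  case zero
  then show ?case by simp
next
  case (monomial_add a p)
  have "Poly_Mapping.keys (Poly_Mapping.single a 1 * q) = (\<lambda>b. a + b) ` Poly_Mapping.keys q"
    by (induction q rule: boolean_poly_mapping_induct)
      (auto simp: distrib_left mult_single keys_boolean_add)
  then show ?case
    using monomial_add by (auto simp: distrib_right keys_boolean_add)
qed

lemma laurent_semiring_simps [simp]:
  "carrier (laurent_semiring k) = {p. Poly_Mapping.keys p \<subseteq> exponents k}"
  "p \<oplus>\<^bsub>laurent_semiring k\<^esub> q = p + q"
  "p \<otimes>\<^bsub>laurent_semiring k\<^esub> q = p * q"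
  "\<one>\<^bsub>laurent_semiring k\<^esub> = 1"
  "\<zero>\<^bsub>laurent_semiring k\<^esub> = 0"
  by (simp_all add: laurent_semiring_def)

lemma keys_laurent_monomial [simp]: "Poly_Mapping.keys (laurent_monomial n) = {n}"
  by (simp add: laurent_monomial_def)

lemma laurent_monomial_mult: "laurent_monomial m * laurent_monomial n = laurent_monomial (m + n)"
  by (simp add: laurent_monomial_def mult_single)

lemma laurent_monomial_0: "laurent_monomial 0 = 1"
  by (simp add: laurent_monomial_def)

lemma exponents_uminus: "n \<in> exponents k \<Longrightarrow> - n \<in> exponents k"
  by (simp add: exponents_def)

lemma exponents_minus: "m \<in> exponents k \<Longrightarrow> n \<in> exponents k \<Longrightarrow> m - n \<in> exponents k"
  using exponents_closed(2)[of m k "- n"] exponents_uminus[of n k] by simp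


section \<open>Congruences of translation-invariant preorders\<close>

lemma congruence_closed:
  assumes "congruence A I" "(a, b) \<in> I" "(c, d) \<in> I"
  shows "(a \<oplus>\<^bsub>A\<^esub> c, b \<oplus>\<^bsub>A\<^esub> d) \<in> I" "(a \<otimes>\<^bsub>A\<^esub> c, b \<otimes>\<^bsub>A\<^esub> d) \<in> I"
  using assms unfolding congruence_def by blast+

lemma congruence_refl: "congruence A I \<Longrightarrow> a \<in> carrier A \<Longrightarrow> (a, a) \<in> I"
  unfolding congruence_def by (meson equivE refl_onD)

lemma congruence_sym: "congruence A I \<Longrightarrow> (a, b) \<in> I \<Longrightarrow> (b, a) \<in> I"
  unfolding congruence_def by (meson equivE symD)

lemma congruence_trans: "congruence A I \<Longrightarrow> (a, b) \<in> I \<Longrightarrow> (b, c) \<in> I \<Longrightarrow> (a, c) \<in> I"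
  unfolding congruence_def by (meson equivE transD)

lemma congruence_subset: "congruence A I \<Longrightarrow> I \<subseteq> carrier A \<times> carrier A"
  unfolding congruence_def equiv_def by blast

text \<open>
  A cone \<open>N\<close> stands for the preorder \<open>a \<le> b \<longleftrightarrow> b - a \<in> N\<close> of the exponents.
\<close>

definition dominated :: "(nat \<Rightarrow>\<^sub>0 int) set \<Rightarrow> laurent \<Rightarrow> laurent \<Rightarrow> bool" where
  "dominated N p q \<longleftrightarrow> (\<forall>a\<in>Poly_Mapping.keys p. \<exists>b\<in>Poly_Mapping.keys q. b - a \<in> N)"

definition order_congruence :: "nat \<Rightarrow> (nat \<Rightarrow>\<^sub>0 int) set \<Rightarrow> (laurent \<times> laurent) set" where
  "order_congruence k N =
     {(p, q). Poly_Mapping.keys p \<subseteq> exponents k \<and> Poly_Mapping.keys q \<subseteq> exponents k \<and>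
        dominated N p q \<and> dominated N q p}"

text \<open>Reflexivity, transitivity and totality of the preorder. Antisymmetry is absent on
  purpose: when \<open>n\<close> and \<open>- n\<close> both lie in \<open>N\<close>, the monomial
  of an exponent \<open>n\<close> becomes congruent to \<open>1\<close>.\<close>

locale total_cone =
  fixes k :: nat and N :: "(nat \<Rightarrow>\<^sub>0 int) set"
  assumes zero_mem: "0 \<in> N"
    and add_mem: "m \<in> N \<Longrightarrow> n \<in> N \<Longrightarrow> m + n \<in> N"
    and total: "n \<in> exponents k \<Longrightarrow> n \<in> N \<or> - n \<in> N"
begin

lemma le_trans: "b - a \<in> N \<Longrightarrow> c - b \<in> N \<Longrightarrow> c - a \<in> N"
  using add_mem[of "b - a" "c - b"] by simp

lemma dominated_refl: "dominated N p p"
  using zero_mem by (auto simp: dominated_def intro!: bexI)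

lemma dominated_trans: "dominated N p q \<Longrightarrow> dominated N q s \<Longrightarrow> dominated N p s"
  unfolding dominated_def by (meson le_trans)

lemma dominated_add: "dominated N p q \<Longrightarrow> dominated N p' q' \<Longrightarrow> dominated N (p + p') (q + q')"
  unfolding dominated_def keys_boolean_add by blast

lemma dominated_mult:
  assumes "dominated N p q" "dominated N p' q'"
  shows "dominated N (p * p') (q * q')"
  unfolding dominated_def
proof
  fix c assume "c \<in> Poly_Mapping.keys (p * p')"
  then obtain a a' where c: "c = a + a'" "a \<in> Poly_Mapping.keys p" "a' \<in> Poly_Mapping.keys p'"
    by (auto simp: keys_boolean_mult)
  then obtain b b' where b: "b \<in> Poly_Mapping.keys q" "b' \<in> Poly_Mapping.keys q'" "b - a \<in> N" "b' - a' \<in> N"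
    using assms unfolding dominated_def by meson
  have "(b + b') - c = (b - a) + (b' - a')"
    using c by simp
  then have "(b + b') - c \<in> N"
    using add_mem b by metis
  then show "\<exists>d\<in>Poly_Mapping.keys (q * q'). d - c \<in> N"
    using b by (auto simp: keys_boolean_mult intro!: bexI[of _ "b + b'"])
qed

lemma congruence_order_congruence: "congruence (laurent_semiring k) (order_congruence k N)"
proof -
  have "equiv (carrier (laurent_semiring k)) (order_congruence k N)"
  proof (rule equivI)
    show "refl_on (carrier (laurent_semiring k)) (order_congruence k N)"
      by (auto simp: refl_on_def order_congruence_def dominated_refl)
    show "trans (order_congruence k N)"
      unfolding trans_def order_congruence_def using dominated_trans by blast
  qed (auto simp: order_congruence_def sym_def)
  moreover have "Poly_Mapping.keys (p * q) \<subseteq> exponents k"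
    if "Poly_Mapping.keys p \<subseteq> exponents k" "Poly_Mapping.keys q \<subseteq> exponents k" for p q :: laurent
    using that exponents_closed(2) by (fastforce simp: keys_boolean_mult)
  ultimately show ?thesis
    unfolding congruence_def
    by (auto simp: order_congruence_def dominated_add dominated_mult)
      (auto simp: keys_boolean_add)
qed

text \<open>By totality a new element can be compared with the old maximum, and transitivity does
  the rest. The maximum need not be unique.\<close>

lemma obtain_maximal_exponent:
  assumes "finite S" "S \<noteq> {}" "S \<subseteq> exponents k"
  obtains m where "m \<in> S" "\<And>a. a \<in> S \<Longrightarrow> m - a \<in> N"
proof -
  have "\<exists>m\<in>S. \<forall>a\<in>S. m - a \<in> N"
    using assms
  proof (induction S rule: finite_ne_induct)
    case (singleton x)
    then show ?case using zero_mem by simp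
  next
    case (insert x S)
    then obtain m where m: "m \<in> S" "\<forall>a\<in>S. m - a \<in> N" by auto
    consider "m - x \<in> N" | "x - m \<in> N"
      using total[of "m - x"] exponents_minus[of m k x] insert.prems m by auto
    then show ?case
    proof cases
      case 1
      then show ?thesis using m by auto
    next
      case 2
      then have "\<forall>a\<in>S. x - a \<in> N" using m le_trans[of m _ x] by blast
      then show ?thesis using zero_mem by auto
    qed
  qed
  then show thesis using that by blast
qed

lemma proper_order_congruence: "proper_congruence (laurent_semiring k) (order_congruence k N)"
proof -
  \<comment> \<open>The exponent \<open>0\<close> of \<open>1\<close> has nothing above it in the
    empty support of \<open>0\<close>, however large \<open>N\<close> is.\<close>
  have "(1, 0) \<notin> order_congruence k N"
    by (simp add: order_congruence_def dominated_def)
  moreover have "(1, 0) \<in> carrier (laurent_semiring k) \<times> carrier (laurent_semiring k)"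
    by (simp add: exponents_closed)
  ultimately show ?thesis
    unfolding proper_congruence_def using congruence_order_congruence by metis
qed

text \<open>An exponent of \<open>q\<close> with nothing of \<open>p\<close> above it may be
  replaced by a leading exponent of \<open>q\<close>: whatever lies above the leading one also lies
  above the former.\<close>

lemma not_dominated_obtain:
  assumes "\<not> dominated N q p" "Poly_Mapping.keys p \<subseteq> exponents k" "Poly_Mapping.keys q \<subseteq> exponents k"
  obtains a where "a \<in> Poly_Mapping.keys q" "\<And>b. b \<in> Poly_Mapping.keys q \<Longrightarrow> a - b \<in> N"
    "\<And>b. b \<in> Poly_Mapping.keys p \<Longrightarrow> b - a \<notin> N"
proof -
  obtain c where c: "c \<in> Poly_Mapping.keys q" "\<And>b. b \<in> Poly_Mapping.keys p \<Longrightarrow> b - c \<notin> N"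
    using assms(1) unfolding dominated_def by blast
  obtain a where a: "a \<in> Poly_Mapping.keys q" "\<And>b. b \<in> Poly_Mapping.keys q \<Longrightarrow> a - b \<in> N"
    using obtain_maximal_exponent[OF finite_keys _ assms(3)] c(1) by blast
  have "b - a \<notin> N" if "b \<in> Poly_Mapping.keys p" for b
    using le_trans[OF a(2)[OF c(1)], of b] c(2)[OF that] by blast
  with a show thesis using that by blast
qed

text \<open>Leading exponents \<open>a\<close> of \<open>p2\<close> and \<open>c\<close> of
  \<open>q2\<close> have nothing above them in \<open>p1\<close> and \<open>q1\<close>. Their sum
  occurs in \<open>p2 * q2\<close>, while each exponent of the other entry has a summand from
  \<open>p1\<close> or \<open>q1\<close> and cannot reach \<open>a + c\<close>.\<close>

lemma not_dominated_twisted: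
  assumes p: "\<not> dominated N p2 p1" and q: "\<not> dominated N q2 q1"
    and exps: "Poly_Mapping.keys p1 \<subseteq> exponents k" "Poly_Mapping.keys p2 \<subseteq> exponents k"
      "Poly_Mapping.keys q1 \<subseteq> exponents k" "Poly_Mapping.keys q2 \<subseteq> exponents k"
  shows "\<not> dominated N (p1 * q1 + p2 * q2) (p1 * q2 + p2 * q1)"
proof
  assume dom: "dominated N (p1 * q1 + p2 * q2) (p1 * q2 + p2 * q1)"
  obtain a where a: "a \<in> Poly_Mapping.keys p2" "\<And>b. b \<in> Poly_Mapping.keys p2 \<Longrightarrow> a - b \<in> N"
    "\<And>b. b \<in> Poly_Mapping.keys p1 \<Longrightarrow> b - a \<notin> N"
    using not_dominated_obtain[OF p] exps by metis
  obtain c where c: "c \<in> Poly_Mapping.keys q2" "\<And>b. b \<in> Poly_Mapping.keys q2 \<Longrightarrow> c - b \<in> N"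
    "\<And>b. b \<in> Poly_Mapping.keys q1 \<Longrightarrow> b - c \<notin> N"
    using not_dominated_obtain[OF q] exps by metis
  have "a + c \<in> Poly_Mapping.keys (p1 * q1 + p2 * q2)"
    using a c by (auto simp: keys_boolean_add keys_boolean_mult)
  then obtain d where d: "d \<in> Poly_Mapping.keys (p1 * q2 + p2 * q1)" "d - (a + c) \<in> N"
    using dom unfolding dominated_def by blast
  from d(1) consider
    u v where "d = u + v" "u \<in> Poly_Mapping.keys p1" "v \<in> Poly_Mapping.keys q2" |
    u v where "d = u + v" "u \<in> Poly_Mapping.keys p2" "v \<in> Poly_Mapping.keys q1"
    by (auto simp: keys_boolean_add keys_boolean_mult)
  then show False
  proof cases
    case 1
    \<comment> \<open>Since \<open>c\<close> is maximal in \<open>q2\<close>, replacing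
      \<open>v\<close> by \<open>c\<close> turns \<open>a + c \<le> u + v\<close> into
      \<open>a \<le> u\<close>, which the choice of \<open>a\<close> excludes.\<close>
    have "u - a = (d - (a + c)) + (c - v)" using 1 by simp
    then show False using add_mem d(2) a c 1 by metis
  next
    case 2
    have "v - c = (d - (a + c)) + (a - u)" using 2 by simp
    then show False using add_mem d(2) a c 2 by metis
  qed
qed

lemma prime_order_congruence: "prime_congruence (laurent_semiring k) (order_congruence k N)"
  unfolding prime_congruence_def
proof (intro conjI ballI impI proper_order_congruence)
  fix \<alpha> \<beta>
  assume "\<alpha> \<in> carrier (laurent_semiring k) \<times> carrier (laurent_semiring k)"
    "\<beta> \<in> carrier (laurent_semiring k) \<times> carrier (laurent_semiring k)"
    and tw: "twisted_product (laurent_semiring k) \<alpha> \<beta> \<in> order_congruence k N"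
  then obtain p1 p2 q1 q2 where eq: "\<alpha> = (p1, p2)" "\<beta> = (q1, q2)"
    and exps: "Poly_Mapping.keys p1 \<subseteq> exponents k" "Poly_Mapping.keys p2 \<subseteq> exponents k"
      "Poly_Mapping.keys q1 \<subseteq> exponents k" "Poly_Mapping.keys q2 \<subseteq> exponents k"
    by auto
  have tw': "dominated N (p1 * q1 + p2 * q2) (p1 * q2 + p2 * q1)"
    "dominated N (p1 * q2 + p2 * q1) (p1 * q1 + p2 * q2)"
    using tw by (auto simp: eq twisted_product_def order_congruence_def)
  \<comment> \<open>A pair outside the congruence fails domination in at least one direction.
    Swapping the entries of one factor only swaps those of the twisted product, so the four
    instances cover all combinations.\<close>
  show "\<alpha> \<in> order_congruence k N \<or> \<beta> \<in> order_congruence k N"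
    using tw' not_dominated_twisted[of p2 p1 q2 q1] not_dominated_twisted[of p1 p2 q2 q1]
      not_dominated_twisted[of p2 p1 q1 q2] not_dominated_twisted[of p1 p2 q1 q2] exps
    by (auto simp: eq order_congruence_def add.commute)
qed

end

text \<open>Modulo a congruence \<open>I\<close> addition is idempotent and \<open>1 + x = x\<close>
  reads as \<open>1 \<le> x\<close>; this is the non-negative cone that \<open>I\<close> induces on
  the exponents.\<close>

definition absorbing_exponents :: "nat \<Rightarrow> (laurent \<times> laurent) set \<Rightarrow> (nat \<Rightarrow>\<^sub>0 int) set" where
  "absorbing_exponents k I =
     {n \<in> exponents k. (1 + laurent_monomial n, laurent_monomial n) \<in> I}"

text \<open>The monomials of \<open>p\<close> are absorbed one at a time: if \<open>b\<close> in
  \<open>q\<close> lies above \<open>a\<close>, multiplying the absorption relation of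
  \<open>b - a\<close> by \<open>x^a\<close> shows that \<open>x^b\<close> absorbs
  \<open>x^a\<close>.\<close>

lemma absorb_dominated:
  assumes I: "congruence (laurent_semiring k) I"
    and N: "N \<inter> exponents k \<subseteq> absorbing_exponents k I"
    and q: "Poly_Mapping.keys q \<subseteq> exponents k"
    and p: "Poly_Mapping.keys p \<subseteq> exponents k" "dominated N p q"
  shows "(p + q, q) \<in> I"
  using p
proof (induction p rule: boolean_poly_mapping_induct)
  case zero
  then show ?case using congruence_refl[OF I, of q] q by simp
next
  case (monomial_add a p)
  let ?x = laurent_monomial
  have x: "Poly_Mapping.single a 1 = ?x a" by (simp add: laurent_monomial_def)
  have IH: "(p + q, q) \<in> I"
    using monomial_add by (auto simp: keys_boolean_add dominated_def)
  have a: "a \<in> exponents k" using monomial_add.prems by (simp add: keys_boolean_add)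
  obtain b where b: "b \<in> Poly_Mapping.keys q" "b - a \<in> N"
    using monomial_add.prems by (auto simp: keys_boolean_add dominated_def)
  have "b - a \<in> exponents k" using a b q exponents_minus by blast
  then have "(1 + ?x (b - a), ?x (b - a)) \<in> I"
    using N b unfolding absorbing_exponents_def by blast
  then have "(?x a * (1 + ?x (b - a)), ?x a * ?x (b - a)) \<in> I"
    using congruence_closed(2)[OF I congruence_refl[OF I]] a by simp
  then have "(?x a + ?x b, ?x b) \<in> I"
    by (simp add: distrib_left laurent_monomial_mult)
  then have "(?x a + ?x b + q, ?x b + q) \<in> I"
    using congruence_closed(1)[OF I _ congruence_refl[OF I]] q by simp
  \<comment> \<open>The monomial \<open>x^b\<close> already occurs in \<open>q\<close>, so adding it
    changes nothing.\<close>
  moreover have "?x b + q = q"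
    using b by (intro boolean_poly_mapping_eqI) (auto simp: keys_boolean_add)
  ultimately have "(?x a + q, q) \<in> I" by (simp add: add.assoc)
  moreover have "(?x a + (p + q), ?x a + q) \<in> I"
    using congruence_closed(1)[OF I congruence_refl[OF I] IH] a by simp
  ultimately show ?case
    using congruence_trans[OF I] by (simp add: x add.assoc)
qed

text \<open>Mutual domination makes \<open>p\<close> and \<open>q\<close> both congruent to
  \<open>p + q\<close>, so the absorption relations force the whole order congruence.\<close>

lemma order_congruence_subset:
  assumes I: "congruence (laurent_semiring k) I"
    and N: "N \<inter> exponents k \<subseteq> absorbing_exponents k I"
  shows "order_congruence k N \<subseteq> I"
proof
  fix z assume "z \<in> order_congruence k N"
  then obtain p q where z: "z = (p, q)" and "Poly_Mapping.keys p \<subseteq> exponents k"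
    "Poly_Mapping.keys q \<subseteq> exponents k" "dominated N p q" "dominated N q p"
    unfolding order_congruence_def by blast
  then have "(p + q, q) \<in> I" "(q + p, p) \<in> I"
    using absorb_dominated[OF I N] by blast+
  then show "z \<in> I"
    unfolding z using congruence_sym[OF I] congruence_trans[OF I] by (metis add.commute)
qed

lemma monomial_mem_order_congruence:
  assumes "0 \<in> N" "n1 \<in> exponents k" "n2 \<in> exponents k"
  shows "(laurent_monomial n1 + laurent_monomial n2, laurent_monomial n2) \<in> order_congruence k N
    \<longleftrightarrow> n2 - n1 \<in> N"
  using assms by (auto simp: order_congruence_def dominated_def keys_boolean_add)

lemma absorbing_exponents_order_congruence:
  assumes "0 \<in> N"
  shows "absorbing_exponents k (order_congruence k N) = N \<inter> exponents k"
  using monomial_mem_order_congruence[OF assms, of 0 k] exponents_closed(1)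
  by (auto simp: absorbing_exponents_def laurent_monomial_0)

text \<open>Chains \<open>1 \<le> x^m\<close> with the translate \<open>x^m \<le> x^(m+n)\<close>:
  modulo \<open>I\<close>, \<open>1 + x^(m+n)\<close> equals \<open>1 + x^m + x^(m+n)\<close>, then
  \<open>x^m + x^(m+n)\<close>, then \<open>x^(m+n)\<close>.\<close>

lemma absorbing_exponents_add:
  assumes I: "congruence (laurent_semiring k) I"
    and m: "m \<in> absorbing_exponents k I" and n: "n \<in> absorbing_exponents k I"
  shows "m + n \<in> absorbing_exponents k I"
proof -
  let ?x = laurent_monomial
  have e: "m \<in> exponents k" "n \<in> exponents k"
    and h: "(1 + ?x m, ?x m) \<in> I" "(1 + ?x n, ?x n) \<in> I"
    using m n by (auto simp: absorbing_exponents_def)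
  have mn: "m + n \<in> exponents k" using e exponents_closed(2) by blast
  have "(?x m * (1 + ?x n), ?x m * ?x n) \<in> I"
    using congruence_closed(2)[OF I congruence_refl[OF I] h(2)] e by simp
  then have 1: "(?x m + ?x (m + n), ?x (m + n)) \<in> I"
    by (simp add: distrib_left laurent_monomial_mult)
  have 2: "(1 + ?x m + ?x (m + n), ?x m + ?x (m + n)) \<in> I"
    using congruence_closed(1)[OF I h(1) congruence_refl[OF I]] mn by simp
  have 3: "(1 + (?x m + ?x (m + n)), 1 + ?x (m + n)) \<in> I"
    using congruence_closed(1)[OF I congruence_refl[OF I] 1] exponents_closed(1) by simp
  have "(1 + ?x (m + n), ?x (m + n)) \<in> I"
    using congruence_trans[OF I congruence_sym[OF I 3] congruence_trans[OF I _ 1]] 2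
    by (simp add: add.assoc)
  then show ?thesis using mn by (simp add: absorbing_exponents_def)
qed

text \<open>Related non-zero polynomials have related leading monomials with respect to
  \<open>N\<close>, whose quotient is then congruent to \<open>1\<close>. The exponents in
  \<open>N\<close> and those of such quotients are absorbing, which yields domination in both
  directions.\<close>

lemma (in total_cone) congruence_eq_order_congruence:
  assumes I: "proper_congruence (laurent_semiring k) I"
    and N: "order_congruence k N \<subseteq> I"
  shows "I = order_congruence k (absorbing_exponents k I)"
proof
  let ?x = laurent_monomial
  let ?M = "absorbing_exponents k I"
  have c: "congruence (laurent_semiring k) I" using I by (simp add: proper_congruence_def)
  show "order_congruence k ?M \<subseteq> I"
    by (rule order_congruence_subset[OF c]) blast
  have NM: "N \<inter> exponents k \<subseteq> ?M"
    using absorbing_exponents_order_congruence[OF zero_mem, of k] N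
    by (auto simp: absorbing_exponents_def)
  have lead: "\<exists>m\<in>Poly_Mapping.keys p. (\<forall>a\<in>Poly_Mapping.keys p. m - a \<in> N) \<and> (p, ?x m) \<in> I"
    if p: "Poly_Mapping.keys p \<subseteq> exponents k" "p \<noteq> 0" for p
  proof -
    obtain m where m: "m \<in> Poly_Mapping.keys p" "\<And>a. a \<in> Poly_Mapping.keys p \<Longrightarrow> m - a \<in> N"
      using obtain_maximal_exponent[OF finite_keys _ p(1)] p(2) by (metis keys_eq_empty)
    have "(p, ?x m) \<in> order_congruence k N"
      using m p zero_mem by (auto simp: order_congruence_def dominated_def intro!: bexI[of _ m])
    with m N show ?thesis by blast
  qed
  \<comment> \<open>Monomials are units: if one were congruent to \<open>0\<close>, so would be
    \<open>1\<close> and then every element, against properness.\<close>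
  have nonzero: "q \<noteq> 0" if pq: "(p, q) \<in> I" "p \<noteq> 0" for p q
  proof
    assume "q = 0"
    have pe: "Poly_Mapping.keys p \<subseteq> exponents k" using pq congruence_subset[OF c] by auto
    then obtain m where m: "m \<in> Poly_Mapping.keys p" "(p, ?x m) \<in> I"
      using lead pq by blast
    have "(?x m, 0) \<in> I"
      using m pq \<open>q = 0\<close> congruence_sym[OF c] congruence_trans[OF c] by metis
    then have "(?x (- m) * ?x m, ?x (- m) * 0) \<in> I"
      using congruence_closed(2)[OF c congruence_refl[OF c], of "?x (- m)" "?x m" 0] pe m
        exponents_uminus[of m k] by auto
    then have one: "(1, 0) \<in> I" by (simp add: laurent_monomial_mult laurent_monomial_0)
    have "(a, 0) \<in> I" if "a \<in> carrier (laurent_semiring k)" for a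
      using congruence_closed(2)[OF c congruence_refl[OF c that] one] by simp
    then have "I = carrier (laurent_semiring k) \<times> carrier (laurent_semiring k)"
      using congruence_subset[OF c] congruence_sym[OF c] congruence_trans[OF c] by blast
    then show False using I by (simp add: proper_congruence_def)
  qed
  have dom: "dominated ?M p q" if pq: "(p, q) \<in> I" for p q
    unfolding dominated_def
  proof
    fix a assume a: "a \<in> Poly_Mapping.keys p"
    have e: "Poly_Mapping.keys p \<subseteq> exponents k" "Poly_Mapping.keys q \<subseteq> exponents k"
      using pq congruence_subset[OF c] by auto
    have "p \<noteq> 0" using a by auto
    then have "q \<noteq> 0" using nonzero pq by blast
    obtain m where m: "m \<in> Poly_Mapping.keys p" "m - a \<in> N" "(p, ?x m) \<in> I"
      using lead[OF e(1) \<open>p \<noteq> 0\<close>] a by blast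
    obtain l where l: "l \<in> Poly_Mapping.keys q" "(q, ?x l) \<in> I"
      using lead[OF e(2) \<open>q \<noteq> 0\<close>] by blast
    have ml: "(?x m, ?x l) \<in> I"
      using m l pq congruence_sym[OF c] congruence_trans[OF c] by metis
    have "- m \<in> exponents k" "l - m \<in> exponents k" "m - a \<in> exponents k"
      using m l a e exponents_uminus exponents_minus by blast+
    \<comment> \<open>Dividing by \<open>x^m\<close> makes \<open>1\<close> congruent to
      \<open>x^(l-m)\<close>; adding \<open>x^(l-m)\<close> to both sides, with idempotency on the
      right, gives an absorption relation.\<close>
    then have "(?x (- m) * ?x m, ?x (- m) * ?x l) \<in> I"
      using congruence_closed(2)[OF c congruence_refl[OF c] ml, of "?x (- m)"] by simp
    then have "(1, ?x (l - m)) \<in> I" by (simp add: laurent_monomial_mult laurent_monomial_0)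
    then have "(1 + ?x (l - m), ?x (l - m) + ?x (l - m)) \<in> I"
      using congruence_closed(1)[OF c _ congruence_refl[OF c, of "?x (l - m)"]] \<open>l - m \<in> exponents k\<close>
      by simp
    moreover have "?x (l - m) + ?x (l - m) = ?x (l - m)"
      by (rule boolean_poly_mapping_eqI) (simp add: keys_boolean_add)
    ultimately have "l - m \<in> ?M"
      using \<open>l - m \<in> exponents k\<close> by (simp add: absorbing_exponents_def)
    moreover have "m - a \<in> ?M" using NM m \<open>m - a \<in> exponents k\<close> by blast
    ultimately have "(l - m) + (m - a) \<in> ?M" using absorbing_exponents_add[OF c] by blast
    then show "\<exists>b\<in>Poly_Mapping.keys q. b - a \<in> ?M" using l by auto
  qed
  show "I \<subseteq> order_congruence k ?M"
  proof
    fix z assume z: "z \<in> I"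
    obtain p q where "z = (p, q)" by fastforce
    then show "z \<in> order_congruence k ?M"
      using z dom congruence_sym[OF c] congruence_subset[OF c]
      by (auto simp: order_congruence_def)
  qed
qed


section \<open>Lexicographic cones\<close>

text \<open>The index \<open>i\<close> counts the coordinates taken into account, so one sequence
  \<open>\<phi>\<close> describes the cones of all truncations; for \<open>i = 0\<close> the cone is
  everything.\<close>

definition lex_nonneg :: "(nat \<Rightarrow> 'a \<Rightarrow> real) \<Rightarrow> nat \<Rightarrow> 'a set" where
  "lex_nonneg \<phi> i =
     {n. (\<forall>j<i. \<phi> j n = 0) \<or> (\<exists>j<i. (\<forall>l<j. \<phi> l n = 0) \<and> 0 < \<phi> j n)}"

lemma not_lex_nonneg:
  assumes "n \<notin> lex_nonneg \<phi> i"
  obtains j where "j < i" "\<forall>l<j. \<phi> l n = 0" "\<phi> j n < 0"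
proof -
  \<comment> \<open>The first non-zero coordinate of \<open>n\<close>. It comes before
    \<open>i\<close>, and a positive value there would put \<open>n\<close> into the cone.\<close>
  define j where "j = (LEAST j. \<phi> j n \<noteq> 0)"
  obtain l where l: "l < i" "\<phi> l n \<noteq> 0" using assms by (auto simp: lex_nonneg_def)
  have "\<phi> j n \<noteq> 0" unfolding j_def by (rule LeastI[of _ l]) (fact l)
  moreover have "j \<le> l" unfolding j_def by (rule Least_le) (fact l)
  moreover have z: "\<forall>l<j. \<phi> l n = 0" unfolding j_def using not_less_Least by blast
  moreover have "\<not> 0 < \<phi> j n"
  proof
    assume "0 < \<phi> j n"
    moreover have "j < i" using l(1) \<open>j \<le> l\<close> by simp
    ultimately show False using assms z by (auto simp: lex_nonneg_def)
  qed
  ultimately show thesis using that[of j] l(1) by force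
qed

text \<open>The first non-zero coordinate below \<open>i\<close>, if any, is positive and does not
  precede \<open>l\<close>: either it is at \<open>l\<close>, or \<open>\<phi> l n\<close> still
  vanishes.\<close>

lemma lex_nonneg_coord:
  assumes "n \<in> lex_nonneg \<phi> i" "l < i" "\<forall>t<l. \<phi> t n = 0"
  shows "0 \<le> \<phi> l n"
proof (cases "\<forall>j<i. \<phi> j n = 0")
  case False
  then obtain j where j: "\<forall>t<j. \<phi> t n = 0" "0 < \<phi> j n"
    using assms(1) by (auto simp: lex_nonneg_def)
  then have "\<not> j < l" using assms(3) by auto
  then show ?thesis using j by (cases "j = l") auto
qed (use assms(2) in simp)

text \<open>A negative leading coordinate found among the first \<open>i\<close> is also the leading
  one among the first \<open>j\<close>.\<close>

lemma lex_nonneg_antimono: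
  assumes "i \<le> j"
  shows "lex_nonneg \<phi> j \<subseteq> lex_nonneg \<phi> i"
proof (rule subsetI, rule ccontr)
  fix n assume n: "n \<in> lex_nonneg \<phi> j" and "n \<notin> lex_nonneg \<phi> i"
  from this(2) obtain l where "l < i" "\<forall>t<l. \<phi> t n = 0" "\<phi> l n < 0"
    by (rule not_lex_nonneg)
  then show False using lex_nonneg_coord[OF n, of l] assms by simp
qed

locale additive_coordinates =
  fixes \<phi> :: "nat \<Rightarrow> 'a::ab_group_add \<Rightarrow> real"
  assumes coord_add: "\<phi> j (m + n) = \<phi> j m + \<phi> j n"
begin

lemma coord_zero: "\<phi> j 0 = 0"
  using coord_add[of j 0 0] by simp

lemma coord_uminus: "\<phi> j (- n) = - \<phi> j n"
  using coord_add[of j n "- n"] coord_zero by simp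

lemma lex_nonneg_zero: "0 \<in> lex_nonneg \<phi> i"
  by (simp add: lex_nonneg_def coord_zero)

text \<open>Suppose the sum leads with a negative coordinate \<open>j\<close>. Before
  \<open>j\<close> the summands vanish one coordinate at a time, being non-negative with sum zero;
  hence both are non-negative at \<open>j\<close>, a contradiction.\<close>

lemma lex_nonneg_add:
  assumes "m \<in> lex_nonneg \<phi> i" "n \<in> lex_nonneg \<phi> i"
  shows "m + n \<in> lex_nonneg \<phi> i"
proof (rule ccontr)
  assume "m + n \<notin> lex_nonneg \<phi> i"
  then obtain j where j: "j < i" "\<forall>l<j. \<phi> l (m + n) = 0" "\<phi> j (m + n) < 0"
    by (rule not_lex_nonneg)
  have "\<phi> l m = 0 \<and> \<phi> l n = 0" if "l < j" for l
    using that
  proof (induction l rule: less_induct)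
    case (less l)
    then have "0 \<le> \<phi> l m" "0 \<le> \<phi> l n" using lex_nonneg_coord[where \<phi> = \<phi> and i = i] assms j(1) by auto
    moreover have "\<phi> l m + \<phi> l n = 0" using j(2) less.prems coord_add by metis
    ultimately show ?case by linarith
  qed
  then have "0 \<le> \<phi> j m" "0 \<le> \<phi> j n" using lex_nonneg_coord[where \<phi> = \<phi> and i = i] assms j(1) by auto
  then show False using j(3) by (simp add: coord_add)
qed

lemma lex_nonneg_total: "n \<in> lex_nonneg \<phi> i \<or> - n \<in> lex_nonneg \<phi> i"
proof (rule disjCI)
  assume "- n \<notin> lex_nonneg \<phi> i"
  then obtain j where "j < i" "\<forall>l<j. \<phi> l (- n) = 0" "\<phi> j (- n) < 0"
    by (rule not_lex_nonneg)
  then show "n \<in> lex_nonneg \<phi> i" by (auto simp: lex_nonneg_def coord_uminus)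
qed

text \<open>
  The units of \<open>M\<close> form a convex subgroup; if \<open>i\<close> is the first coordinate that does
  not vanish on it, then by the Archimedean property it contains every element whose coordinates
  before \<open>i\<close> vanish.
\<close>

lemma semigroup_above_lex_nonneg:
  assumes E: "\<And>n. n \<in> E \<Longrightarrow> - n \<in> E" "\<And>m n. m \<in> E \<Longrightarrow> n \<in> E \<Longrightarrow> m + n \<in> E"
    and M: "M \<subseteq> E" "\<And>m n. m \<in> M \<Longrightarrow> n \<in> M \<Longrightarrow> m + n \<in> M"
    and lex: "lex_nonneg \<phi> r \<inter> E \<subseteq> M"
  shows "\<exists>i\<le>r. M = lex_nonneg \<phi> i \<inter> E"
proof -
  \<comment> \<open>\<open>Q j h\<close> says that \<open>h\<close> is a unit of \<open>M\<close>
    with first non-zero coordinate \<open>j\<close>.\<close>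
  define Q where "Q j h \<longleftrightarrow> h \<in> M \<and> - h \<in> M \<and> (\<forall>l<j. \<phi> l h = 0) \<and> \<phi> j h \<noteq> 0" for j h
  \<comment> \<open>The alternative \<open>j = r\<close> is the default when all units vanish on the
    first \<open>r\<close> coordinates.\<close>
  define i where "i = (LEAST j. j = r \<or> (\<exists>h. Q j h))"
  have i: "i = r \<or> (\<exists>h. Q i h)"
    unfolding i_def by (rule LeastI[of _ r]) simp
  have ir: "i \<le> r" unfolding i_def by (rule Least_le) simp
  have noQ: "\<not> Q j h" if "j < i" for j h
    using not_less_Least[of j] that unfolding i_def by blast
  have units: "\<phi> j h = 0" if "h \<in> M" "- h \<in> M" "j < i" for h j
    using that(3)
  proof (induction j rule: less_induct)
    case (less j)
    then show ?case using noQ[of j h] that(1,2) unfolding Q_def by auto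
  qed
  have ker: "g \<in> M" if g: "g \<in> E" "\<forall>l<i. \<phi> l g = 0" for g
  proof (cases "i = r")
    case True
    then show ?thesis using g lex by (auto simp: lex_nonneg_def)
  next
    case False
    then obtain h0 where h0: "Q i h0" using i by blast
    \<comment> \<open>Both signs of a unit are units, so the coordinate \<open>i\<close> can be made
      positive.\<close>
    define h where "h = (if \<phi> i h0 > 0 then h0 else - h0)"
    have h: "h \<in> M" "- h \<in> M" "\<forall>l<i. \<phi> l h = 0" "\<phi> i h > 0"
      using h0 by (auto simp: Q_def h_def coord_uminus)
    \<comment> \<open>Induction on the number \<open>t\<close> of copies of \<open>h\<close> needed
      to make coordinate \<open>i\<close> positive: \<open>f + h\<close> needs one less, and adding
      the unit \<open>- h\<close> returns to \<open>f\<close>. For \<open>t = 0\<close> the element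
      is in the cone of level \<open>r\<close>, as \<open>i < r\<close>.\<close>
    have *: "f \<in> M" if "f \<in> E" "\<forall>l<i. \<phi> l f = 0" "\<phi> i f + real t * \<phi> i h > 0" for t f
      using that
    proof (induction t arbitrary: f)
      case 0
      then have "0 < \<phi> i f" "i < r" using False ir by simp_all
      then have "f \<in> lex_nonneg \<phi> r" using 0 unfolding lex_nonneg_def by blast
      then show ?case using lex 0 by blast
    next
      case (Suc t)
      have "f + h \<in> M"
        using Suc.prems h M(1) E(2) by (intro Suc.IH) (auto simp: coord_add algebra_simps)
      then show ?case using M(2)[OF _ h(2)] by fastforce
    qed
    obtain t where "real t * \<phi> i h > - \<phi> i g" using reals_Archimedean3[OF h(4)] by blast
    then show ?thesis using *[OF g, of t] by linarith
  qed
  have "n \<in> M" if n: "n \<in> lex_nonneg \<phi> i" "n \<in> E" for n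
  proof (cases "\<forall>j<i. \<phi> j n = 0")
    case True
    then show ?thesis using ker n by blast
  next
    case False
    then obtain j where "j < i" "\<forall>l<j. \<phi> l n = 0" "0 < \<phi> j n"
      using n(1) unfolding lex_nonneg_def by blast
    then have "n \<in> lex_nonneg \<phi> r"
      using order_less_le_trans[OF _ ir] unfolding lex_nonneg_def by blast
    then show ?thesis using lex n by blast
  qed
  \<comment> \<open>A lexicographically negative \<open>n\<close> has \<open>- n\<close> in the cone
    of level \<open>r\<close>, hence in \<open>M\<close>. It would be a unit with a non-zero
    coordinate before \<open>i\<close>.\<close>
  moreover have "n \<in> lex_nonneg \<phi> i" if n: "n \<in> M" for n
  proof (rule ccontr)
    assume "n \<notin> lex_nonneg \<phi> i"
    then obtain j where j: "j < i" "\<forall>l<j. \<phi> l n = 0" "\<phi> j n < 0"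
      by (rule not_lex_nonneg)
    then have "j < r" "\<forall>l<j. \<phi> l (- n) = 0" "0 < \<phi> j (- n)"
      using ir by (simp_all add: coord_uminus)
    then have "- n \<in> lex_nonneg \<phi> r" unfolding lex_nonneg_def by blast
    then have "- n \<in> M" using lex M(1) n E(1) by blast
    then show False using units[OF n] j by auto
  qed
  ultimately show ?thesis using ir M(1) by blast
qed


end


section \<open>The congruence of a matrix\<close>

definition coord :: "real mat \<Rightarrow> nat \<Rightarrow> (nat \<Rightarrow>\<^sub>0 int) \<Rightarrow> real" where
  "coord U j n = row U j \<bullet> exponent_vec (dim_col U) n"

definition matrix_cone :: "real mat \<Rightarrow> (nat \<Rightarrow>\<^sub>0 int) set" where
  "matrix_cone U = lex_nonneg (coord U) (dim_row U)"

lemma coord_additive: "coord U j (m + n) = coord U j m + coord U j n"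
proof -
  have "exponent_vec (dim_col U) (m + n) = exponent_vec (dim_col U) m + exponent_vec (dim_col U) n"
    by (intro eq_vecI) (simp_all add: exponent_vec_def lookup_add)
  then show ?thesis
    by (simp add: coord_def scalar_prod_add_distrib[of _ "dim_col U"] exponent_vec_def)
qed

interpretation coord: additive_coordinates "coord U" for U
  by unfold_locales (rule coord_additive)

interpretation lex: total_cone k "lex_nonneg (coord U) i" for U i k
  using coord.lex_nonneg_zero coord.lex_nonneg_add coord.lex_nonneg_total by unfold_locales blast+

interpretation cone: total_cone k "matrix_cone U" for U k
  unfolding matrix_cone_def by (rule lex.total_cone_axioms)

lemma mem_matrix_cone_iff:
  "n \<in> matrix_cone U \<longleftrightarrow>
     (let v = U *\<^sub>v exponent_vec (dim_col U) n in
        v = 0\<^sub>v (dim_row U) \<or> (\<exists>i. first_nonzero_at v i \<and> v $ i > 0))"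
proof -
  let ?v = "U *\<^sub>v exponent_vec (dim_col U) n"
  have v: "?v $ j = coord U j n" if "j < dim_row U" for j
    using that by (simp add: coord_def)
  have "?v = 0\<^sub>v (dim_row U) \<longleftrightarrow> (\<forall>j<dim_row U. coord U j n = 0)"
    using v by (auto simp: vec_eq_iff)
  moreover have "first_nonzero_at ?v i \<and> ?v $ i > 0 \<longleftrightarrow>
      i < dim_row U \<and> (\<forall>l<i. coord U l n = 0) \<and> 0 < coord U i n" for i
    using v by (auto simp: first_nonzero_at_def)
  ultimately show ?thesis
    by (simp add: matrix_cone_def lex_nonneg_def Let_def)
qed

text \<open>The order congruence contains the generators. Conversely, the generators with
  \<open>n1 = 0\<close> are exactly absorption relations, so any congruence containing them contains
  the order congruence.\<close>

lemma matrix_congruence_eq: "matrix_congruence U = order_congruence (dim_col U) (matrix_cone U)"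
proof -
  let ?k = "dim_col U"
  let ?gens = "{(laurent_monomial n1 + laurent_monomial n2, laurent_monomial n2) | n1 n2.
    n1 \<in> exponents ?k \<and> n2 \<in> exponents ?k \<and> n2 - n1 \<in> matrix_cone U}"
  have gen: "matrix_congruence U = generated_congruence (laurent_semiring ?k) ?gens"
    unfolding matrix_congruence_def mem_matrix_cone_iff ..
  have "?gens \<subseteq> order_congruence ?k (matrix_cone U)"
    using monomial_mem_order_congruence[OF cone.zero_mem] by blast
  then have "generated_congruence (laurent_semiring ?k) ?gens \<subseteq> order_congruence ?k (matrix_cone U)"
    using cone.congruence_order_congruence unfolding generated_congruence_def by blast
  moreover have "order_congruence ?k (matrix_cone U) \<subseteq> I"
    if I: "congruence (laurent_semiring ?k) I" "?gens \<subseteq> I" for I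
  proof (rule order_congruence_subset[OF I(1)], rule subsetI)
    fix n assume n: "n \<in> matrix_cone U \<inter> exponents ?k"
    then have "(laurent_monomial 0 + laurent_monomial n, laurent_monomial n) \<in> ?gens"
      using exponents_closed(1) by fastforce
    then show "n \<in> absorbing_exponents ?k I"
      using n subsetD[OF I(2)] by (simp add: absorbing_exponents_def laurent_monomial_0)
  qed
  ultimately show ?thesis
    unfolding gen by (intro antisym) (simp_all add: generated_congruence_def le_Inf_iff)
qed

section \<open>Truncated matrices and the chain of their congruences\<close>

lemma first_rows_dim [simp]:
  "dim_col (first_rows U i) = dim_col U"
  "i \<le> dim_row U \<Longrightarrow> dim_row (first_rows U i) = i"
  by (simp_all add: first_rows_def)

lemma coord_first_rows:
  assumes "i \<le> dim_row U" "j < i"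
  shows "coord (first_rows U i) j = coord U j"
proof -
  have "row (first_rows U i) j = row U j"
    using assms unfolding first_rows_def by (subst mat_of_rows_row) auto
  then show ?thesis by (auto simp: coord_def)
qed

lemma matrix_cone_first_rows:
  assumes "i \<le> dim_row U"
  shows "matrix_cone (first_rows U i) = lex_nonneg (coord U) i"
  using coord_first_rows[OF assms] assms by (auto simp: matrix_cone_def lex_nonneg_def)

lemma matrix_congruence_first_rows:
  assumes "i \<le> dim_row U"
  shows "matrix_congruence (first_rows U i) = order_congruence (dim_col U) (lex_nonneg (coord U) i)"
  using assms by (simp add: matrix_congruence_eq matrix_cone_first_rows)

lemma matrix_congruence_first_rows_all:
  "matrix_congruence (first_rows U (dim_row U)) = matrix_congruence U"
  by (simp only: matrix_congruence_eq first_rows_dim matrix_cone_first_rows[OF order_refl]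
      matrix_cone_def[of U])

text \<open>Domination between elements of the carrier only tests differences of exponents. This
  reconciles \<open>absorbing_exponents\<close>, which lies in \<open>exponents k\<close>, with
  lexicographic cones, which need not.\<close>

lemma order_congruence_Int_exponents:
  "order_congruence k (N \<inter> exponents k) = order_congruence k N"
proof -
  have "b - a \<in> exponents k" if "a \<in> Poly_Mapping.keys p" "b \<in> Poly_Mapping.keys q"
    "Poly_Mapping.keys p \<subseteq> exponents k" "Poly_Mapping.keys q \<subseteq> exponents k" for a b and p q :: laurent
    using that exponents_minus by blast
  then have "dominated (N \<inter> exponents k) p q = dominated N p q"
    if "Poly_Mapping.keys p \<subseteq> exponents k" "Poly_Mapping.keys q \<subseteq> exponents k" for p q
    using that unfolding dominated_def by blast
  then show ?thesis unfolding order_congruence_def by blast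
qed

lemma congruence_above_matrix_congruence:
  assumes I: "proper_congruence (laurent_semiring (dim_col U)) I"
    and U: "matrix_congruence U \<subseteq> I"
  shows "\<exists>i\<le>dim_row U. I = matrix_congruence (first_rows U i)"
proof -
  let ?k = "dim_col U"
  let ?M = "absorbing_exponents ?k I"
  have c: "congruence (laurent_semiring ?k) I" using I by (simp add: proper_congruence_def)
  have eq: "I = order_congruence ?k ?M"
    using cone.congruence_eq_order_congruence[OF I, of U] U by (simp add: matrix_congruence_eq)
  have "matrix_cone U \<inter> exponents ?k \<subseteq> ?M"
    using absorbing_exponents_order_congruence[OF cone.zero_mem, of ?k U] U
    unfolding matrix_congruence_eq by (auto simp: absorbing_exponents_def)
  then have "\<exists>i\<le>dim_row U. ?M = lex_nonneg (coord U) i \<inter> exponents ?k"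
    unfolding matrix_cone_def
    using absorbing_exponents_add[OF c] exponents_uminus exponents_closed(2)
    by (intro coord.semigroup_above_lex_nonneg) (auto simp: absorbing_exponents_def)
  then show ?thesis
    using eq by (metis order_congruence_Int_exponents matrix_congruence_first_rows)
qed

lemma order_congruence_mono: "M \<subseteq> N \<Longrightarrow> order_congruence k M \<subseteq> order_congruence k N"
  unfolding order_congruence_def dominated_def by blast

lemma matrix_congruence_first_rows_psubset:
  assumes "admissible U" "i < dim_row U"
  shows "matrix_congruence (first_rows U (Suc i)) \<subset> matrix_congruence (first_rows U i)"
proof -
  let ?k = "dim_col U" and ?N = "lex_nonneg (coord U)"
  obtain n0 where n0: "n0 \<in> exponents ?k" "first_nonzero_at (U *\<^sub>v exponent_vec ?k n0) i"
    using assms unfolding admissible_def by blast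
  then have c0: "\<forall>j<i. coord U j n0 = 0" "coord U i n0 \<noteq> 0"
    using assms(2) by (auto simp: first_nonzero_at_def coord_def)
  \<comment> \<open>Admissibility supplies a vector leading at row \<open>i\<close>; with negative
    sign it is in the cone of \<open>i\<close> rows, which ignores that row, but not in the cone of
    \<open>Suc i\<close> rows.\<close>
  define n where "n = (if coord U i n0 < 0 then n0 else - n0)"
  have n: "n \<in> exponents ?k" "\<forall>j<i. coord U j n = 0" "coord U i n < 0"
    using n0(1) c0 exponents_uminus by (auto simp: n_def coord.coord_uminus)
  have "n \<in> ?N i" using n by (simp add: lex_nonneg_def)
  moreover have "n \<notin> ?N (Suc i)"
    using coord.lex_nonneg_zero lex_nonneg_coord[of n "coord U" "Suc i" i] n by auto
  \<comment> \<open>Absorbing exponents recover the cone within \<open>exponents ?k\<close>, so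
    different cones give different congruences.\<close>
  ultimately have "absorbing_exponents ?k (order_congruence ?k (?N (Suc i))) \<noteq>
      absorbing_exponents ?k (order_congruence ?k (?N i))"
    using n(1) absorbing_exponents_order_congruence[OF coord.lex_nonneg_zero] by blast
  then have "order_congruence ?k (?N (Suc i)) \<noteq> order_congruence ?k (?N i)" by metis
  moreover have "order_congruence ?k (?N (Suc i)) \<subseteq> order_congruence ?k (?N i)"
    by (intro order_congruence_mono lex_nonneg_antimono) simp
  ultimately show ?thesis
    using assms(2) by (auto simp: matrix_congruence_first_rows)
qed


section \<open>Congruences of a quotient\<close>

definition pullback_congruence ::
    "('a, 'm) ring_scheme \<Rightarrow> ('a \<times> 'a) set \<Rightarrow> ('a set \<times> 'a set) set \<Rightarrow> ('a \<times> 'a) set" where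
  "pullback_congruence A P J = {(a, b) \<in> carrier A \<times> carrier A. (P `` {a}, P `` {b}) \<in> J}"

definition pushforward_congruence :: "('a \<times> 'a) set \<Rightarrow> ('a \<times> 'a) set \<Rightarrow> ('a set \<times> 'a set) set" where
  "pushforward_congruence P I = (\<lambda>(a, b). (P `` {a}, P `` {b})) ` I"

locale semiring_congruence = semiring A for A (structure) +
  fixes P
  assumes P: "congruence A P"
begin

abbreviation Q where "Q \<equiv> quotient_semiring A P"

lemma carrier_quotient: "carrier Q = (\<lambda>a. P `` {a}) ` carrier A"
  by (auto simp: quotient_semiring_def quotient_def)

lemma class_eq_iff: "a \<in> carrier A \<Longrightarrow> b \<in> carrier A \<Longrightarrow> P `` {a} = P `` {b} \<longleftrightarrow> (a, b) \<in> P"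
  using P eq_equiv_class_iff unfolding congruence_def by metis

lemma pullback_mem:
  "a \<in> carrier A \<Longrightarrow> b \<in> carrier A \<Longrightarrow> (a, b) \<in> pullback_congruence A P J \<longleftrightarrow> (P `` {a}, P `` {b}) \<in> J"
  by (simp add: pullback_congruence_def)

lemma congruence_pullback:
  assumes J: "congruence Q J"
  shows "congruence A (pullback_congruence A P J)"
proof -
  have "equiv (carrier A) (pullback_congruence A P J)"
  proof (rule equivI)
    show "refl_on (carrier A) (pullback_congruence A P J)"
      using congruence_refl[OF J] by (auto simp: refl_on_def pullback_congruence_def carrier_quotient)
    show "sym (pullback_congruence A P J)"
      using congruence_sym[OF J] by (auto simp: sym_def pullback_congruence_def)
    show "trans (pullback_congruence A P J)"
      using congruence_trans[OF J] unfolding trans_def pullback_congruence_def by blast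
  qed (auto simp: pullback_congruence_def)
  moreover have "(a \<oplus> c, b \<oplus> d) \<in> pullback_congruence A P J \<and>
      (a \<otimes> c, b \<otimes> d) \<in> pullback_congruence A P J"
    if "(a, b) \<in> pullback_congruence A P J" "(c, d) \<in> pullback_congruence A P J" for a b c d
    using that congruence_closed[OF J, of "P `` {a}" "P `` {b}" "P `` {c}" "P `` {d}"]
    by (auto simp: pullback_congruence_def quotient_semiring_ops[OF P])
  ultimately show ?thesis unfolding congruence_def by blast
qed

lemma subset_pullback:
  assumes J: "congruence Q J"
  shows "P \<subseteq> pullback_congruence A P J"
proof
  fix z assume "z \<in> P"
  moreover obtain a b where "z = (a, b)" by fastforce
  ultimately have z: "z = (a, b)" "(a, b) \<in> P" "a \<in> carrier A" "b \<in> carrier A"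
    using congruence_subset[OF P] by auto
  then have "P `` {a} = P `` {b}" using class_eq_iff by blast
  then show "z \<in> pullback_congruence A P J"
    using z congruence_refl[OF J, of "P `` {a}"] by (simp add: pullback_mem carrier_quotient)
qed

text \<open>Every element of the quotient has a representative. In particular pullback is injective
  on congruences, which later bounds the length of chains.\<close>

lemma pushforward_pullback:
  assumes J: "congruence Q J"
  shows "pushforward_congruence P (pullback_congruence A P J) = J"
proof
  show "J \<subseteq> pushforward_congruence P (pullback_congruence A P J)"
  proof
    fix z assume "z \<in> J"
    moreover then obtain a b where "z = (P `` {a}, P `` {b})" "a \<in> carrier A" "b \<in> carrier A"
      using congruence_subset[OF J] unfolding carrier_quotient by blast
    ultimately show "z \<in> pushforward_congruence P (pullback_congruence A P J)"
      unfolding pushforward_congruence_def by (auto simp: pullback_mem intro!: image_eqI[of _ _ "(a, b)"])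
  qed
qed (auto simp: pushforward_congruence_def pullback_congruence_def)

lemma proper_pullback:
  assumes J: "proper_congruence Q J"
  shows "proper_congruence A (pullback_congruence A P J)"
proof -
  have c: "congruence Q J" using J by (simp add: proper_congruence_def)
  have "pushforward_congruence P (carrier A \<times> carrier A) = carrier Q \<times> carrier Q"
    unfolding pushforward_congruence_def carrier_quotient by force
  then have "pullback_congruence A P J \<noteq> carrier A \<times> carrier A"
    using J pushforward_pullback[OF c] by (auto simp: proper_congruence_def)
  then show ?thesis using congruence_pullback[OF c] by (simp add: proper_congruence_def)
qed

text \<open>Twisted products of classes are computed on representatives, so primality descends to
  the quotient.\<close>

lemma prime_of_prime_pullback:
  assumes J: "proper_congruence Q J" and prime: "prime_congruence A (pullback_congruence A P J)"
  shows "prime_congruence Q J"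
  unfolding prime_congruence_def
proof (intro conjI ballI impI J)
  fix \<alpha> \<beta>
  assume "\<alpha> \<in> carrier Q \<times> carrier Q" "\<beta> \<in> carrier Q \<times> carrier Q"
    and tw: "twisted_product Q \<alpha> \<beta> \<in> J"
  then obtain a b c d where eq: "\<alpha> = (P `` {a}, P `` {b})" "\<beta> = (P `` {c}, P `` {d})"
    and car: "a \<in> carrier A" "b \<in> carrier A" "c \<in> carrier A" "d \<in> carrier A"
    unfolding carrier_quotient by blast
  have "twisted_product A (a, b) (c, d) \<in> pullback_congruence A P J"
    using tw car by (simp add: eq twisted_product_def quotient_semiring_ops[OF P] pullback_mem)
  then have "(a, b) \<in> pullback_congruence A P J \<or> (c, d) \<in> pullback_congruence A P J"
    using prime car unfolding prime_congruence_def by blast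
  then show "\<alpha> \<in> J \<or> \<beta> \<in> J"
    using car by (simp add: eq pullback_mem)
qed

text \<open>Because \<open>P \<subseteq> I\<close>, representatives can be exchanged within their
  classes without leaving \<open>I\<close>. The congruence axioms of the image can then be checked
  on representatives.\<close>

lemma pushforward_mem:
  assumes I: "congruence A I" "P \<subseteq> I" and "a \<in> carrier A" "b \<in> carrier A"
  shows "(P `` {a}, P `` {b}) \<in> pushforward_congruence P I \<longleftrightarrow> (a, b) \<in> I"
proof
  assume "(P `` {a}, P `` {b}) \<in> pushforward_congruence P I"
  then obtain c d where cd: "(c, d) \<in> I" "P `` {a} = P `` {c}" "P `` {b} = P `` {d}"
    unfolding pushforward_congruence_def by auto
  then have "(a, c) \<in> I" "(b, d) \<in> I"
    using assms congruence_subset[OF I(1)] class_eq_iff by blast+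
  then show "(a, b) \<in> I"
    using cd(1) congruence_sym[OF I(1)] congruence_trans[OF I(1)] by metis
qed (force simp: pushforward_congruence_def)

lemma pullback_pushforward:
  assumes I: "congruence A I" "P \<subseteq> I"
  shows "pullback_congruence A P (pushforward_congruence P I) = I"
  using pushforward_mem[OF I] congruence_subset[OF I(1)]
  by (auto simp: pullback_congruence_def)

lemma pushforward_subset:
  assumes "congruence A I"
  shows "pushforward_congruence P I \<subseteq> carrier Q \<times> carrier Q"
  using congruence_subset[OF assms] by (auto simp: pushforward_congruence_def carrier_quotient)

lemma congruence_pushforward:
  assumes I: "congruence A I" "P \<subseteq> I"
  shows "congruence Q (pushforward_congruence P I)"
proof -
  note mem = pushforward_mem[OF I]
  have "equiv (carrier Q) (pushforward_congruence P I)"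
  proof (rule equivI)
    show "pushforward_congruence P I \<subseteq> carrier Q \<times> carrier Q"
      by (rule pushforward_subset[OF I(1)])
    show "refl_on (carrier Q) (pushforward_congruence P I)"
      using congruence_refl[OF I(1)] by (auto simp: refl_on_def carrier_quotient mem)
    show "sym (pushforward_congruence P I)"
      using congruence_sym[OF I(1)] by (force simp: sym_def pushforward_congruence_def)
    show "trans (pushforward_congruence P I)"
    proof (rule transI)
      fix x y z assume xy: "(x, y) \<in> pushforward_congruence P I"
        and yz: "(y, z) \<in> pushforward_congruence P I"
      then obtain a b c where "x = P `` {a}" "y = P `` {b}" "z = P `` {c}"
        and "a \<in> carrier A" "b \<in> carrier A" "c \<in> carrier A"
        using pushforward_subset[OF I(1)] unfolding carrier_quotient by blast
      then show "(x, z) \<in> pushforward_congruence P I"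
        using xy yz congruence_trans[OF I(1), of a b c] by (simp add: mem)
    qed
  qed
  moreover have "(w \<oplus>\<^bsub>Q\<^esub> y, x \<oplus>\<^bsub>Q\<^esub> z) \<in> pushforward_congruence P I \<and>
      (w \<otimes>\<^bsub>Q\<^esub> y, x \<otimes>\<^bsub>Q\<^esub> z) \<in> pushforward_congruence P I"
    if wx: "(w, x) \<in> pushforward_congruence P I" and yz: "(y, z) \<in> pushforward_congruence P I" for w x y z
  proof -
    obtain a b where "w = P `` {a}" "x = P `` {b}" "a \<in> carrier A" "b \<in> carrier A"
      using wx pushforward_subset[OF I(1)] unfolding carrier_quotient by blast
    moreover obtain c d where "y = P `` {c}" "z = P `` {d}" "c \<in> carrier A" "d \<in> carrier A"
      using yz pushforward_subset[OF I(1)] unfolding carrier_quotient by blast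
    ultimately show ?thesis
      using wx yz congruence_closed[OF I(1), of a b c d] by (simp add: mem quotient_semiring_ops[OF P])
  qed
  ultimately show ?thesis unfolding congruence_def by blast
qed

lemma proper_pushforward:
  assumes I: "proper_congruence A I" "P \<subseteq> I"
  shows "proper_congruence Q (pushforward_congruence P I)"
proof -
  have c: "congruence A I" using I by (simp add: proper_congruence_def)
  have "pullback_congruence A P (carrier Q \<times> carrier Q) = carrier A \<times> carrier A"
    by (auto simp: pullback_congruence_def carrier_quotient)
  then have "pushforward_congruence P I \<noteq> carrier Q \<times> carrier Q"
    using I(1) pullback_pushforward[OF c I(2)] by (auto simp: proper_congruence_def)
  then show ?thesis using congruence_pushforward[OF c I(2)] by (simp add: proper_congruence_def)
qed

end

section \<open>Dimension of the quotient and conclusion\<close>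

lemma semiring_dim_eqI:
  assumes "prime_chain A r C" "\<And>n C. prime_chain A n C \<Longrightarrow> n \<le> r"
  shows "semiring_dim A = ereal (real r)"
  unfolding semiring_dim_def using assms by (intro antisym SUP_least SUP_upper) auto

theorem proposition4p4:
  fixes U :: "real mat" and r k :: nat
  assumes "U \<in> carrier_mat r k" and "admissible U"
  shows "(\<forall>I. proper_congruence (laurent_semiring k) I \<longrightarrow> matrix_congruence U \<subseteq> I \<longrightarrow>
                 (\<exists>i\<le>r. I = matrix_congruence (first_rows U i)))
       \<and> (matrix_congruence U = matrix_congruence (first_rows U r))
       \<and> (\<forall>i<r. matrix_congruence (first_rows U (Suc i)) \<subset> matrix_congruence (first_rows U i))
       \<and> (\<forall>J. proper_congruence (quotient_semiring (laurent_semiring k) (matrix_congruence U)) J \<longrightarrow>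
                 prime_congruence (quotient_semiring (laurent_semiring k) (matrix_congruence U)) J)
       \<and> (semiring_dim (quotient_semiring (laurent_semiring k) (matrix_congruence U)) = ereal (real r))"
proof -
  let ?A = "laurent_semiring k" and ?P = "matrix_congruence U"
  let ?R = "\<lambda>i. matrix_congruence (first_rows U i)"
  let ?push = "pushforward_congruence ?P" and ?pull = "pullback_congruence ?A ?P"
  have dims [simp]: "dim_row U = r" "dim_col U = k" using assms(1) by auto
  have "congruence ?A ?P"
    using cone.congruence_order_congruence by (simp add: matrix_congruence_eq)
  then interpret semiring_congruence ?A ?P
    using semiring_laurent_semiring
    by (simp add: semiring_congruence_def semiring_congruence_axioms_def)
  have above: "\<exists>i\<le>r. I = ?R i" if "proper_congruence ?A I" "?P \<subseteq> I" for I
    using congruence_above_matrix_congruence[of U I] that by simp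
  have R_eq: "?R i = order_congruence k (lex_nonneg (coord U) i)" if "i \<le> r" for i
    using matrix_congruence_first_rows[of i U] that by simp
  have P_eq: "?P = ?R r" using matrix_congruence_first_rows_all[of U] by simp
  have strict: "?R (Suc i) \<subset> ?R i" if "i < r" for i
    using matrix_congruence_first_rows_psubset[OF assms(2), of i] that by simp
  have R_prime: "prime_congruence ?A (?R i)" if "i \<le> r" for i
    using lex.prime_order_congruence R_eq[OF that] by simp
  have R_mono: "?R j \<subseteq> ?R i" if "i \<le> j" "j \<le> r" for i j
    using that R_eq order_congruence_mono[OF lex_nonneg_antimono] by simp
  have prime: "prime_congruence Q J" if J: "proper_congruence Q J" for J
  proof -
    have "congruence Q J" using J by (simp add: proper_congruence_def)
    then obtain i where "i \<le> r" "?pull J = ?R i"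
      using above[OF proper_pullback[OF J]] subset_pullback by blast
    then show ?thesis using prime_of_prime_pullback[OF J] R_prime by simp
  qed
  have R_above: "proper_congruence ?A (?R i)" "congruence ?A (?R i)" "?P \<subseteq> ?R i" if "i \<le> r" for i
    using R_prime[OF that] R_mono[OF that] P_eq
    by (auto simp: prime_congruence_def proper_congruence_def)
  \<comment> \<open>The index is reversed because \<open>prime_chain\<close> ascends while the
    congruences shrink as rows are added.\<close>
  have "prime_chain Q r (\<lambda>i. ?push (?R (r - i)))"
    unfolding prime_chain_def
  proof (intro conjI allI impI)
    fix i assume "i \<le> r"
    show "prime_congruence Q (?push (?R (r - i)))"
      by (intro prime proper_pushforward R_above) simp_all
  next
    fix i assume "i < r"
    then have s: "?R (r - i) \<subset> ?R (r - Suc i)"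
      using strict[of "r - Suc i"] by (simp add: Suc_diff_Suc)
    moreover have "?pull (?push (?R (r - i))) = ?R (r - i)"
      "?pull (?push (?R (r - Suc i))) = ?R (r - Suc i)"
      by (intro pullback_pushforward R_above; simp)+
    \<comment> \<open>Pulling back recovers both congruences, so equal images would contradict
      strictness.\<close>
    ultimately have "?push (?R (r - i)) \<noteq> ?push (?R (r - Suc i))" by (metis psubsetE)
    moreover have "?push (?R (r - i)) \<subseteq> ?push (?R (r - Suc i))"
      using s unfolding pushforward_congruence_def by blast
    ultimately show "?push (?R (r - i)) \<subset> ?push (?R (r - Suc i))" by blast
  qed
  moreover have "n \<le> r" if C: "prime_chain Q n C" for n C
  proof -
    have CJ: "proper_congruence Q (C i)" "congruence Q (C i)" if "i \<le> n" for i
      using C that by (auto simp: prime_chain_def prime_congruence_def proper_congruence_def)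
    \<comment> \<open>An arbitrary prime chain of the quotient is labelled by the truncations to
      which its members pull back.\<close>
    have "\<forall>i\<in>{..n}. \<exists>j. j \<le> r \<and> ?pull (C i) = ?R j"
      using above[OF proper_pullback] CJ subset_pullback by (metis atMost_iff)
    then obtain f where f: "\<And>i. i \<le> n \<Longrightarrow> f i \<le> r" "\<And>i. i \<le> n \<Longrightarrow> ?pull (C i) = ?R (f i)"
      by (metis atMost_iff)
    have less: "C i \<subset> C j" if "i < j" "j \<le> n" for i j
      using that
    proof (induction j)
      case (Suc j)
      then have "C j \<subset> C (Suc j)" using C by (simp add: prime_chain_def)
      then show ?case using Suc by (cases "i = j") auto
    qed simp
    \<comment> \<open>Distinct members have distinct pullbacks, hence distinct labels; so
      \<open>n + 1\<close> members need at most the \<open>r + 1\<close> available labels.\<close>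
    have inj: "inj_on f {..n}"
    proof (rule linorder_inj_onI)
      fix i j assume ij: "i < j" "i \<in> {..n}" "j \<in> {..n}"
      then have "C i \<noteq> C j" using less by blast
      then show "f i \<noteq> f j"
        using ij f(2)[of i] f(2)[of j] pushforward_pullback[OF CJ(2)] by (metis atMost_iff)
    qed auto
    have "card {..n} \<le> card {..r}"
      using f(1) by (intro card_inj_on_le[OF inj]) auto
    then show ?thesis by simp
  qed
  ultimately have "semiring_dim Q = ereal (real r)" by (rule semiring_dim_eqI)
  then show ?thesis using above P_eq strict prime by blast
qed

end
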